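(* Let $G$ be a Polish Roelcke precompact group. Then every transitive, isometric, continuous action $G\curvearrowright X$ on a Polish metric space $(X,d)$ is uniformly micro-transitive; that is, for every neighborhood $U$ of the identity in $G$ there is $\delta>0$ such that $B_\delta(x)\cap Gx\subseteq Ux$ for all $x\in X$, where $B_\delta(x)=\{y\in X:d(x,y)<\delta\}$.
   Context: The Roelcke uniformity of a topological group $G$ is the intersection $\mathcal U_L\cap\mathcal U_R$ of its left and right uniformities. A Polish group is Roelcke precompact if its Roelcke uniformity is totally bounded; equivalently, for every neighborhood $U$ of the identity there is a finite set $F\subseteq G$ with $G=UFU$. A Polish metric space is a separable complete metric space. *)

theory Defs
  imports "HOL-Analysis.Analysis" "HOL-Algebra.Group_Action"
begin

section \<open>Polish groups and Polish metric spaces\<close>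

locale topological_group = group G for G (structure) +
  fixes T
  assumes topspace_eq: "topspace T = carrier G"
    and continuous_mult: "continuous_map (prod_topology T T) T (\<lambda>(x, y). x \<otimes> y)"
    and continuous_inv: "continuous_map T T (\<lambda>x. inv x)"

locale polish_group = topological_group +
  assumes completely_metrizable: "completely_metrizable_space T"
    and separable: "separable_space T"

locale polish_metric_space = Metric_space +
  assumes complete: "mcomplete"
    and separable: "separable_space mtopology"

text \<open>Neighborhoods of the identity; they need not be open.\<close>

definition one_nbhd :: "('a, 'c) monoid_scheme \<Rightarrow> 'a topology \<Rightarrow> 'a set \<Rightarrow> bool"
  where "one_nbhd G T U \<longleftrightarrow> U \<subseteq> carrier G \<and> (\<exists>V. openin T V \<and> \<one>\<^bsub>G\<^esub> \<in> V \<and> V \<subseteq> U)"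

section \<open>The Roelcke uniformity\<close>

text \<open>Uniformities on a set, given by their entourages.\<close>

definition uniformity_structure :: "'a set \<Rightarrow> ('a \<times> 'a) set set \<Rightarrow> bool"
  where "uniformity_structure S \<U> \<longleftrightarrow>
    \<U> \<noteq> {} \<and>
    (\<forall>E\<in>\<U>. E \<subseteq> S \<times> S \<and> Id_on S \<subseteq> E) \<and>
    (\<forall>E\<in>\<U>. \<forall>D. E \<subseteq> D \<and> D \<subseteq> S \<times> S \<longrightarrow> D \<in> \<U>) \<and>
    (\<forall>E\<in>\<U>. \<forall>D\<in>\<U>. E \<inter> D \<in> \<U>) \<and>
    (\<forall>E\<in>\<U>. E\<inverse> \<in> \<U>) \<and>
    (\<forall>E\<in>\<U>. \<exists>D\<in>\<U>. D O D \<subseteq> E)"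

definition totally_bounded_uniformity :: "'a set \<Rightarrow> ('a \<times> 'a) set set \<Rightarrow> bool"
  where "totally_bounded_uniformity S \<U> \<longleftrightarrow>
    (\<forall>E\<in>\<U>. \<exists>F. finite F \<and> F \<subseteq> S \<and> S \<subseteq> E `` F)"

definition left_uniformity :: "('a, 'c) monoid_scheme \<Rightarrow> 'a topology \<Rightarrow> ('a \<times> 'a) set set"
  where "left_uniformity G T = {E. E \<subseteq> carrier G \<times> carrier G \<and>
    (\<exists>U. one_nbhd G T U \<and>
      {(x, y). x \<in> carrier G \<and> y \<in> carrier G \<and> inv\<^bsub>G\<^esub> x \<otimes>\<^bsub>G\<^esub> y \<in> U} \<subseteq> E)}"

definition right_uniformity :: "('a, 'c) monoid_scheme \<Rightarrow> 'a topology \<Rightarrow> ('a \<times> 'a) set set"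
  where "right_uniformity G T = {E. E \<subseteq> carrier G \<times> carrier G \<and>
    (\<exists>U. one_nbhd G T U \<and>
      {(x, y). x \<in> carrier G \<and> y \<in> carrier G \<and> y \<otimes>\<^bsub>G\<^esub> inv\<^bsub>G\<^esub> x \<in> U} \<subseteq> E)}"

text \<open>
  The intersection of the left and right uniformities is their infimum in the lattice of
  uniformities: the finest uniformity contained in both. The intersection of the two families
  of entourages can be strictly larger, as it need not satisfy the composition axiom; the union
  below is the largest uniformity inside it (lemma \<open>roelcke_uniformity_greatest\<close>).
\<close>

definition roelcke_uniformity :: "('a, 'c) monoid_scheme \<Rightarrow> 'a topology \<Rightarrow> ('a \<times> 'a) set set"
  where "roelcke_uniformity G T =
    \<Union> {\<U>. uniformity_structure (carrier G) \<U> \<and>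
           \<U> \<subseteq> left_uniformity G T \<inter> right_uniformity G T}"

definition roelcke_precompact :: "('a, 'c) monoid_scheme \<Rightarrow> 'a topology \<Rightarrow> bool"
  where "roelcke_precompact G T \<longleftrightarrow>
    totally_bounded_uniformity (carrier G) (roelcke_uniformity G T)"

context topological_group
begin

lemma one_nbhd_Int:
  assumes "one_nbhd G T U" "one_nbhd G T V"
  shows "one_nbhd G T (U \<inter> V)"
proof -
  obtain U' V' where "openin T U'" "\<one> \<in> U'" "U' \<subseteq> U" "openin T V'" "\<one> \<in> V'" "V' \<subseteq> V"
    using assms unfolding one_nbhd_def by auto
  then have "openin T (U' \<inter> V')" "\<one> \<in> U' \<inter> V'" "U' \<inter> V' \<subseteq> U \<inter> V"
    by auto
  then show ?thesis
    using assms unfolding one_nbhd_def by blast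
qed

lemma one_nbhd_one: "one_nbhd G T U \<Longrightarrow> \<one> \<in> U"
  unfolding one_nbhd_def by auto

lemma one_nbhd_inverse:
  assumes "one_nbhd G T U"
  shows "one_nbhd G T {x \<in> carrier G. inv x \<in> U}"
proof -
  obtain V where V: "openin T V" "\<one> \<in> V" "V \<subseteq> U"
    using assms unfolding one_nbhd_def by auto
  have "openin T {x \<in> topspace T. inv x \<in> V}"
    using openin_continuous_map_preimage[OF continuous_inv V(1)] .
  then show ?thesis
    unfolding one_nbhd_def topspace_eq
    by (intro conjI exI[of _ "{x \<in> carrier G. inv x \<in> V}"]) (use V in auto)
qed

lemma one_nbhd_square:
  assumes "one_nbhd G T U"
  obtains V where "one_nbhd G T V" "\<And>x y. x \<in> V \<Longrightarrow> y \<in> V \<Longrightarrow> x \<otimes> y \<in> U"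
proof -
  obtain W where W: "openin T W" "\<one> \<in> W" "W \<subseteq> U"
    using assms unfolding one_nbhd_def by auto
  let ?P = "{z \<in> topspace (prod_topology T T). (case z of (x, y) \<Rightarrow> x \<otimes> y) \<in> W}"
  have "openin (prod_topology T T) ?P"
    using openin_continuous_map_preimage[OF continuous_mult W(1)] .
  moreover have "(\<one>, \<one>) \<in> ?P"
    using W by (simp add: topspace_eq)
  ultimately obtain A B where AB: "openin T A" "openin T B" "\<one> \<in> A" "\<one> \<in> B" "A \<times> B \<subseteq> ?P"
    unfolding openin_prod_topology_alt by meson
  have "A \<subseteq> carrier G"
    using AB(1) openin_subset topspace_eq by blast
  then have "one_nbhd G T (A \<inter> B)"
    unfolding one_nbhd_def using AB by (intro conjI exI[of _ "A \<inter> B"]) auto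
  moreover have "x \<otimes> y \<in> U" if "x \<in> A \<inter> B" "y \<in> A \<inter> B" for x y
  proof -
    have "(x, y) \<in> ?P"
      using that AB(5) by blast
    then show ?thesis
      using W by auto
  qed
  ultimately show ?thesis
    using that by blast
qed

definition roelcke_entourage :: "'a set \<Rightarrow> ('a \<times> 'a) set"
  where "roelcke_entourage U = {(x, y). x \<in> carrier G \<and> (\<exists>u\<in>U. \<exists>v\<in>U. y = u \<otimes> x \<otimes> v)}"

definition roelcke_filter :: "('a \<times> 'a) set set"
  where "roelcke_filter = {E. E \<subseteq> carrier G \<times> carrier G \<and>
    (\<exists>U. one_nbhd G T U \<and> roelcke_entourage U \<subseteq> E)}"

lemma one_nbhd_carrier: "one_nbhd G T (carrier G)"
  unfolding one_nbhd_def using topspace_eq by (metis one_closed openin_topspace subset_refl)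

lemma roelcke_entourage_mono: "U \<subseteq> V \<Longrightarrow> roelcke_entourage U \<subseteq> roelcke_entourage V"
  unfolding roelcke_entourage_def by blast

lemma roelcke_entourage_subset: "U \<subseteq> carrier G \<Longrightarrow> roelcke_entourage U \<subseteq> carrier G \<times> carrier G"
  unfolding roelcke_entourage_def by auto

lemma roelcke_entourage_converse:
  assumes "U \<subseteq> carrier G"
  shows "roelcke_entourage {x \<in> carrier G. inv x \<in> U} \<subseteq> (roelcke_entourage U)\<inverse>"
proof clarify
  fix x y assume "(x, y) \<in> roelcke_entourage {x \<in> carrier G. inv x \<in> U}"
  then obtain u v where uv: "x \<in> carrier G" "u \<in> carrier G" "v \<in> carrier G" "inv u \<in> U" "inv v \<in> U"
    "y = u \<otimes> x \<otimes> v"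
    unfolding roelcke_entourage_def by auto
  then have "x = inv u \<otimes> y \<otimes> inv v" "y \<in> carrier G"
    by (simp_all add: m_assoc inv_solve_left)
  then show "(y, x) \<in> roelcke_entourage U"
    unfolding roelcke_entourage_def using uv by blast
qed

lemma roelcke_entourage_comp:
  assumes "V \<subseteq> carrier G" "\<And>x y. x \<in> V \<Longrightarrow> y \<in> V \<Longrightarrow> x \<otimes> y \<in> U"
  shows "roelcke_entourage V O roelcke_entourage V \<subseteq> roelcke_entourage U"
proof clarify
  fix x y z assume "(x, y) \<in> roelcke_entourage V" "(y, z) \<in> roelcke_entourage V"
  then obtain u v u' v' where *: "x \<in> carrier G" "u \<in> V" "v \<in> V" "u' \<in> V" "v' \<in> V"
    "y = u \<otimes> x \<otimes> v" "z = u' \<otimes> y \<otimes> v'"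
    unfolding roelcke_entourage_def by auto
  then have "z = (u' \<otimes> u) \<otimes> x \<otimes> (v \<otimes> v')"
    using assms(1) by (simp add: m_assoc subset_iff)
  then show "(x, z) \<in> roelcke_entourage U"
    unfolding roelcke_entourage_def using * assms(2) by blast
qed

lemma roelcke_filterI:
  "E \<subseteq> carrier G \<times> carrier G \<Longrightarrow> one_nbhd G T U \<Longrightarrow> roelcke_entourage U \<subseteq> E \<Longrightarrow> E \<in> roelcke_filter"
  unfolding roelcke_filter_def by blast

lemma roelcke_filterE:
  assumes "E \<in> roelcke_filter"
  obtains U where "one_nbhd G T U" "U \<subseteq> carrier G" "roelcke_entourage U \<subseteq> E" "E \<subseteq> carrier G \<times> carrier G"
  using assms unfolding roelcke_filter_def one_nbhd_def by blast

lemma roelcke_entourageI: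
  "x \<in> carrier G \<Longrightarrow> u \<in> U \<Longrightarrow> v \<in> U \<Longrightarrow> y = u \<otimes> x \<otimes> v \<Longrightarrow> (x, y) \<in> roelcke_entourage U"
  unfolding roelcke_entourage_def by auto

lemma uniformity_structure_roelcke_filter: "uniformity_structure (carrier G) roelcke_filter"
  unfolding uniformity_structure_def
proof (intro conjI ballI allI impI)
  have "carrier G \<times> carrier G \<in> roelcke_filter"
    by (rule roelcke_filterI[OF _ one_nbhd_carrier]) (simp_all add: roelcke_entourage_subset)
  then show "roelcke_filter \<noteq> {}"
    by auto
next
  fix E assume "E \<in> roelcke_filter"
  then show "E \<subseteq> carrier G \<times> carrier G"
    by (rule roelcke_filterE)
next
  fix E assume "E \<in> roelcke_filter"
  then obtain U where U: "one_nbhd G T U" "roelcke_entourage U \<subseteq> E"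
    by (rule roelcke_filterE)
  have "(x, x) \<in> roelcke_entourage U" if "x \<in> carrier G" for x
    using that one_nbhd_one[OF U(1)] by (intro roelcke_entourageI[of _ \<one> _ \<one>]) auto
  then show "Id_on (carrier G) \<subseteq> E"
    using U(2) by auto
next
  fix E D assume E: "E \<in> roelcke_filter" and D: "E \<subseteq> D \<and> D \<subseteq> carrier G \<times> carrier G"
  obtain U where "one_nbhd G T U" "roelcke_entourage U \<subseteq> E"
    using E by (rule roelcke_filterE)
  with D show "D \<in> roelcke_filter"
    by (intro roelcke_filterI[of D U]) auto
next
  fix E D assume E: "E \<in> roelcke_filter" and D: "D \<in> roelcke_filter"
  obtain U where U: "one_nbhd G T U" "roelcke_entourage U \<subseteq> E" "E \<subseteq> carrier G \<times> carrier G"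
    using E by (rule roelcke_filterE)
  obtain V where V: "one_nbhd G T V" "roelcke_entourage V \<subseteq> D"
    using D by (rule roelcke_filterE)
  have "roelcke_entourage (U \<inter> V) \<subseteq> E \<inter> D"
    using roelcke_entourage_mono[of "U \<inter> V" U] roelcke_entourage_mono[of "U \<inter> V" V] U(2) V(2)
    by auto
  with U(3) show "E \<inter> D \<in> roelcke_filter"
    by (intro roelcke_filterI[OF _ one_nbhd_Int[OF U(1) V(1)]]) auto
next
  fix E assume "E \<in> roelcke_filter"
  then obtain U where U: "one_nbhd G T U" "U \<subseteq> carrier G" "roelcke_entourage U \<subseteq> E"
    "E \<subseteq> carrier G \<times> carrier G"
    by (rule roelcke_filterE)
  have "roelcke_entourage {x \<in> carrier G. inv x \<in> U} \<subseteq> E\<inverse>"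
    using roelcke_entourage_converse[OF U(2)] U(3) by auto
  with U(4) show "E\<inverse> \<in> roelcke_filter"
    by (intro roelcke_filterI[OF _ one_nbhd_inverse[OF U(1)]]) auto
next
  fix E assume "E \<in> roelcke_filter"
  then obtain U where U: "one_nbhd G T U" "roelcke_entourage U \<subseteq> E"
    by (rule roelcke_filterE)
  obtain V where V: "one_nbhd G T V" "\<And>x y. x \<in> V \<Longrightarrow> y \<in> V \<Longrightarrow> x \<otimes> y \<in> U"
    using one_nbhd_square[OF U(1)] by blast
  from V(1) have VG: "V \<subseteq> carrier G"
    unfolding one_nbhd_def by simp
  have "roelcke_entourage V \<in> roelcke_filter"
    by (rule roelcke_filterI[OF roelcke_entourage_subset[OF VG] V(1)]) simp
  moreover have "roelcke_entourage V O roelcke_entourage V \<subseteq> E"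
    using subset_trans[OF roelcke_entourage_comp[OF VG V(2)] U(2)] .
  ultimately show "\<exists>D\<in>roelcke_filter. D O D \<subseteq> E"
    by (rule bexI[rotated])
qed

lemma roelcke_filter_subset: "roelcke_filter \<subseteq> left_uniformity G T \<inter> right_uniformity G T"
proof
  fix E assume "E \<in> roelcke_filter"
  then obtain U where U: "one_nbhd G T U" "roelcke_entourage U \<subseteq> E" "E \<subseteq> carrier G \<times> carrier G"
    by (rule roelcke_filterE)
  have 1: "\<one> \<in> U"
    using U(1) by (rule one_nbhd_one)
  have "(x, y) \<in> E" if "x \<in> carrier G" "y \<in> carrier G" "inv x \<otimes> y \<in> U" for x y
  proof -
    have "y = \<one> \<otimes> x \<otimes> (inv x \<otimes> y)"
      using that by (simp add: m_assoc[symmetric])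
    then show ?thesis
      using roelcke_entourageI[OF that(1) 1 that(3)] U(2) by auto
  qed
  moreover have "(x, y) \<in> E" if "x \<in> carrier G" "y \<in> carrier G" "y \<otimes> inv x \<in> U" for x y
  proof -
    have "y = (y \<otimes> inv x) \<otimes> x \<otimes> \<one>"
      using that by (simp add: m_assoc)
    then show ?thesis
      using roelcke_entourageI[OF that(1,3) 1] U(2) by auto
  qed
  ultimately show "E \<in> left_uniformity G T \<inter> right_uniformity G T"
    unfolding left_uniformity_def right_uniformity_def using U(1,3)
    by (intro IntI CollectI conjI exI[of _ U]) auto
qed

lemma uniformity_subset_roelcke_filter:
  assumes "uniformity_structure (carrier G) \<U>" "\<U> \<subseteq> left_uniformity G T \<inter> right_uniformity G T"
  shows "\<U> \<subseteq> roelcke_filter"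
proof
  fix E assume E: "E \<in> \<U>"
  then obtain D where D: "D \<in> \<U>" "D O D \<subseteq> E"
    using assms(1) unfolding uniformity_structure_def by meson
  obtain U where U: "one_nbhd G T U"
    "{(x, y). x \<in> carrier G \<and> y \<in> carrier G \<and> inv x \<otimes> y \<in> U} \<subseteq> D"
    using D assms(2) unfolding left_uniformity_def by blast
  obtain V where V: "one_nbhd G T V"
    "{(x, y). x \<in> carrier G \<and> y \<in> carrier G \<and> y \<otimes> inv x \<in> V} \<subseteq> D"
    using D assms(2) unfolding right_uniformity_def by blast
  have "roelcke_entourage (U \<inter> V) \<subseteq> E"
  proof clarify
    fix x y assume "(x, y) \<in> roelcke_entourage (U \<inter> V)"
    then obtain u v where uv: "x \<in> carrier G" "u \<in> V" "v \<in> U" "y = u \<otimes> x \<otimes> v"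
      unfolding roelcke_entourage_def by auto
    have c: "u \<in> carrier G" "v \<in> carrier G"
      using uv U(1) V(1) unfolding one_nbhd_def by auto
    have "(x, u \<otimes> x) \<in> D"
      using V(2) uv c by (auto simp: m_assoc)
    moreover have "inv (u \<otimes> x) \<otimes> y = v"
      using uv(1,4) c m_assoc[of "inv (u \<otimes> x)" "u \<otimes> x" v] by (simp del: inv_mult_group)
    then have "(u \<otimes> x, y) \<in> D"
      using U(2) uv c by auto
    ultimately show "(x, y) \<in> E"
      using D(2) by blast
  qed
  moreover have "E \<subseteq> carrier G \<times> carrier G"
    using E assms(1) unfolding uniformity_structure_def by simp
  ultimately show "E \<in> roelcke_filter"
    by (intro roelcke_filterI[OF _ one_nbhd_Int[OF U(1) V(1)]])
qed

lemma roelcke_uniformity_eq_filter: "roelcke_uniformity G T = roelcke_filter"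
  unfolding roelcke_uniformity_def
proof (intro equalityI Sup_least Sup_upper CollectI conjI)
  show "uniformity_structure (carrier G) roelcke_filter"
    by (rule uniformity_structure_roelcke_filter)
qed (use uniformity_subset_roelcke_filter roelcke_filter_subset in auto)

theorem roelcke_uniformity_greatest:
  shows "uniformity_structure (carrier G) (roelcke_uniformity G T)"
    and "roelcke_uniformity G T \<subseteq> left_uniformity G T \<inter> right_uniformity G T"
    and "uniformity_structure (carrier G) \<U> \<Longrightarrow>
      \<U> \<subseteq> left_uniformity G T \<inter> right_uniformity G T \<Longrightarrow> \<U> \<subseteq> roelcke_uniformity G T"
  using roelcke_uniformity_eq_filter uniformity_structure_roelcke_filter roelcke_filter_subset
    uniformity_subset_roelcke_filter by auto

theorem roelcke_precompact_iff:
  "roelcke_precompact G T \<longleftrightarrow>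
    (\<forall>U. one_nbhd G T U \<longrightarrow> (\<exists>F. finite F \<and> F \<subseteq> carrier G \<and> carrier G = U <#> F <#> U))"
proof -
  have eq: "roelcke_entourage U `` F = U <#> F <#> U" if "F \<subseteq> carrier G" for U F
    using that unfolding roelcke_entourage_def set_mult_def
    by (auto simp: Image_iff subset_iff)
  have sub: "U <#> F <#> U \<subseteq> carrier G" if "F \<subseteq> carrier G" "one_nbhd G T U" for U F
    using that unfolding one_nbhd_def by (simp add: set_mult_closed)
  show ?thesis
  proof (intro iffI allI impI)
    fix U assume "roelcke_precompact G T" and U: "one_nbhd G T U"
    moreover have "roelcke_entourage U \<in> roelcke_filter"
      using U by (intro roelcke_filterI[OF roelcke_entourage_subset U]) (auto simp: one_nbhd_def)
    ultimately obtain F where "finite F" "F \<subseteq> carrier G" "carrier G \<subseteq> roelcke_entourage U `` F"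
      unfolding roelcke_precompact_def totally_bounded_uniformity_def roelcke_uniformity_eq_filter
      by blast
    then show "\<exists>F. finite F \<and> F \<subseteq> carrier G \<and> carrier G = U <#> F <#> U"
      using eq[of F U] sub[of F U] U by (intro exI[of _ F]) auto
  next
    assume *: "\<forall>U. one_nbhd G T U \<longrightarrow> (\<exists>F. finite F \<and> F \<subseteq> carrier G \<and> carrier G = U <#> F <#> U)"
    show "roelcke_precompact G T"
      unfolding roelcke_precompact_def totally_bounded_uniformity_def roelcke_uniformity_eq_filter
    proof
      fix E assume "E \<in> roelcke_filter"
      then obtain U where U: "one_nbhd G T U" "roelcke_entourage U \<subseteq> E"
        by (rule roelcke_filterE)
      from *[rule_format, OF U(1)]
      obtain F where F: "finite F" "F \<subseteq> carrier G" "carrier G = U <#> F <#> U"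
        by (elim exE conjE)
      have "U <#> F <#> U \<subseteq> E `` F"
        using Image_mono[OF U(2) subset_refl] unfolding eq[OF F(2), symmetric] .
      then have "carrier G \<subseteq> E `` F"
        by (rule ord_eq_le_trans[OF F(3)])
      with F(1,2) show "\<exists>F. finite F \<and> F \<subseteq> carrier G \<and> carrier G \<subseteq> E `` F"
        by (intro exI[of _ F] conjI)
    qed
  qed
qed

end

section \<open>Isometric continuous actions\<close>

text \<open>Continuity of the action is joint continuity.\<close>

locale isometric_continuous_action =
  topological_group G T + Metric_space X d + group_action G X \<phi>
  for G (structure) and T and X and d and \<phi> +
  assumes isometric: "\<lbrakk>g \<in> carrier G; x \<in> X; y \<in> X\<rbrakk> \<Longrightarrow> d (\<phi> g x) (\<phi> g y) = d x y"
    and continuous: "continuous_map (prod_topology T mtopology) mtopology (\<lambda>(g, x). \<phi> g x)"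

definition uniformly_micro_transitive ::
  "('a, 'c) monoid_scheme \<Rightarrow> 'a topology \<Rightarrow> 'b set \<Rightarrow> ('b \<Rightarrow> 'b \<Rightarrow> real) \<Rightarrow> ('a \<Rightarrow> 'b \<Rightarrow> 'b) \<Rightarrow> bool"
  where "uniformly_micro_transitive G T X d \<phi> \<longleftrightarrow>
    (\<forall>U. one_nbhd G T U \<longrightarrow>
      (\<exists>\<delta>>0. \<forall>x\<in>X. Metric_space.mball X d x \<delta> \<inter> orbit G \<phi> x \<subseteq> (\<lambda>g. \<phi> g x) ` U))"

end

theory Submission
  imports Defs "HOL-Library.Diagonal_Subsequence"
begin

text \<open>
  By Effros' theorem every \<open>U x\<close> is a neighborhood of \<open>x\<close>; the point is uniformity in \<open>x\<close>. If it
  fails for \<open>U\<close>, there are points \<open>g n x0\<close> whose balls of radius tending to 0 are not inside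
  \<open>U (g n x0)\<close>. Roelcke precompactness yields a subsequence in which consecutive terms differ by
  rapidly shrinking factors on both sides, so \<open>g n = t n a (w n)\<close> with all \<open>t n\<close> in a small
  neighborhood \<open>V\<close> of the identity and \<open>w n x0\<close> Cauchy. Near the limit \<open>z\<close> of \<open>w n x0\<close>, which lies in \<open>X\<close> by
  completeness, Effros' theorem holds with a uniform radius for the neighborhood \<open>inv a V a\<close>;
  translating isometrically by \<open>t n a\<close> turns this neighborhood into one inside \<open>U\<close>, a contradiction.
\<close>

section \<open>Sequences in metric and uniform spaces\<close>

lemma (in Metric_space) geometric_dist_le:
  assumes "\<And>n. \<sigma> n \<in> M" and "\<And>n. d (\<sigma> n) (\<sigma> (Suc n)) \<le> c / 2 ^ n"
  shows "d (\<sigma> m) (\<sigma> (m + k)) \<le> 2 * c / 2 ^ m"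
proof -
  have "0 \<le> c"
    using order_trans[OF nonneg assms(2)[of 0]] by simp
  \<comment> \<open>Subtracting the tail of the geometric series gives a bound that passes through
    the induction.\<close>
  have "d (\<sigma> m) (\<sigma> (m + k)) \<le> 2 * c / 2 ^ m - 2 * c / 2 ^ (m + k)"
  proof (induction k)
    case 0
    then show ?case
      using assms(1) by simp
  next
    case (Suc k)
    have "d (\<sigma> m) (\<sigma> (m + Suc k)) \<le> d (\<sigma> m) (\<sigma> (m + k)) + c / 2 ^ (m + k)"
      using triangle[of "\<sigma> m" "\<sigma> (m + k)" "\<sigma> (m + Suc k)"] assms(1) assms(2)[of "m + k"]
      by simp
    moreover have "2 * c / 2 ^ (m + Suc k) = c / 2 ^ (m + k)"
      and "2 * c / 2 ^ (m + k) = c / 2 ^ (m + k) + c / 2 ^ (m + k)"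
      by simp_all
    ultimately show ?case
      using Suc by linarith
  qed
  moreover have "0 \<le> 2 * c / 2 ^ (m + k)"
    using \<open>0 \<le> c\<close> by simp
  ultimately show ?thesis
    by linarith
qed

lemma (in Metric_space) geometric_MCauchy:
  assumes "\<And>n. \<sigma> n \<in> M" and "\<And>n. d (\<sigma> n) (\<sigma> (Suc n)) \<le> c / 2 ^ n"
  shows "MCauchy \<sigma>"
  unfolding MCauchy_def
proof (intro conjI allI impI)
  show "range \<sigma> \<subseteq> M"
    using assms(1) by auto
  fix \<epsilon> :: real assume "\<epsilon> > 0"
  \<comment> \<open>The factor 4 arises because two late terms are compared through
    \<open>\<sigma> N\<close>, at a cost of at most \<open>2 * c / 2 ^ N\<close> each.\<close>
  have "(\<lambda>m. 4 * c * (1 / 2) ^ m) \<longlonglongrightarrow> 4 * c * 0"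
    by (intro tendsto_mult_left LIMSEQ_power_zero) simp
  then have "\<forall>\<^sub>F m in sequentially. 4 * c * (1 / 2) ^ m < \<epsilon>"
    using \<open>\<epsilon> > 0\<close> by (simp add: order_tendstoD(2))
  then obtain N where N: "4 * c * (1 / 2) ^ N < \<epsilon>"
    unfolding eventually_sequentially by blast
  have *: "d (\<sigma> N) (\<sigma> n) \<le> 2 * c / 2 ^ N" if "N \<le> n" for n
    using geometric_dist_le[OF assms, of N "n - N"] that by simp
  have "d (\<sigma> n) (\<sigma> n') < \<epsilon>" if "N \<le> n" "N \<le> n'" for n n'
    using triangle[of "\<sigma> n" "\<sigma> N" "\<sigma> n'"] assms(1) *[OF that(1)] *[OF that(2)] N
    by (simp add: commute[of "\<sigma> n" "\<sigma> N"] power_divide)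
  then show "\<exists>N. \<forall>n n'. N \<le> n \<longrightarrow> N \<le> n' \<longrightarrow> d (\<sigma> n) (\<sigma> n') < \<epsilon>"
    by blast
qed

lemma (in Metric_space) geometric_limit:
  assumes "mcomplete" and "\<And>n. \<sigma> n \<in> M" and "\<And>n. d (\<sigma> n) (\<sigma> (Suc n)) \<le> c / 2 ^ n"
  obtains l where "limitin mtopology \<sigma> l sequentially" "l \<in> M" "d (\<sigma> 0) l \<le> 2 * c"
proof -
  obtain l where l: "limitin mtopology \<sigma> l sequentially"
    using geometric_MCauchy[OF assms(2,3)] assms(1) unfolding mcomplete_def by blast
  then have "l \<in> M" "(\<lambda>n. d (\<sigma> n) l) \<longlonglongrightarrow> 0"
    by (simp_all add: limitin_metric_dist_null)
  then have "(\<lambda>n. 2 * c + d (\<sigma> n) l) \<longlonglongrightarrow> 2 * c + 0"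
    by (intro tendsto_add tendsto_const)
  moreover have "d (\<sigma> 0) l \<le> 2 * c + d (\<sigma> n) l" for n
    using triangle[of "\<sigma> 0" "\<sigma> n" l] assms(2) \<open>l \<in> M\<close> geometric_dist_le[OF assms(2,3), of 0 n]
    by simp
  ultimately have "d (\<sigma> 0) l \<le> 2 * c"
    by (intro LIMSEQ_le_const[where X = "\<lambda>n. 2 * c + d (\<sigma> n) l"]) auto
  with l \<open>l \<in> M\<close> that show ?thesis
    by blast
qed

text \<open>For a single entourage, total boundedness and the pigeonhole principle give a
  subsequence all of whose terms are close to each other; a diagonal sequence then handles all
  \<open>E n\<close>.\<close>

lemma totally_bounded_uniformity_subseq:
  fixes x :: "nat \<Rightarrow> 'a" and E :: "nat \<Rightarrow> ('a \<times> 'a) set"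
  assumes unif: "uniformity_structure S \<U>" and tb: "totally_bounded_uniformity S \<U>"
    and x: "\<And>n. x n \<in> S" and E: "\<And>n. E n \<in> \<U>"
  obtains r :: "nat \<Rightarrow> nat" where "strict_mono r" "\<And>n. (x (r n), x (r (Suc n))) \<in> E n"
proof -
  interpret subseqs "\<lambda>n s. \<forall>i j. (x (s i), x (s j)) \<in> E n"
  proof
    fix n and s :: "nat \<Rightarrow> nat" assume "strict_mono s"
    obtain D where D: "D \<in> \<U>" "D O D \<subseteq> E n"
      using unif E unfolding uniformity_structure_def by meson
    \<comment> \<open>Symmetry allows passing from one term to the common center and from there to
      another term, which is a step in \<open>D O D\<close>.\<close>
    have "D \<inter> D\<inverse> \<in> \<U>"
      using unif D(1) unfolding uniformity_structure_def by meson
    then obtain F where F: "finite F" "S \<subseteq> (D \<inter> D\<inverse>) `` F"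
      using tb unfolding totally_bounded_uniformity_def by meson
    have "\<forall>i. \<exists>f\<in>F. (f, x (s i)) \<in> D \<inter> D\<inverse>"
      using F(2) x by blast
    then obtain f where f: "\<And>i. f i \<in> F" "\<And>i. (f i, x (s i)) \<in> D \<inter> D\<inverse>"
      by metis
    have "finite (range f)"
      using F(1) f(1) by (meson finite_subset image_subsetI)
    then obtain a where "infinite {i. f i = a}"
      using pigeonhole_infinite[of UNIV f] by auto
    then obtain r :: "nat \<Rightarrow> nat" where r: "strict_mono r" "\<And>i. f (r i) = a"
      using infinite_enumerate[of "{i. f i = a}"] by auto
    have "(x (s (r i)), x (s (r j))) \<in> D O D" for i j
      using f(2)[of "r i"] f(2)[of "r j"] unfolding r(2) by blast
    then show "\<exists>r :: nat \<Rightarrow> nat. strict_mono r \<and> (\<forall>i j. (x ((s \<circ> r) i), x ((s \<circ> r) j)) \<in> E n)"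
      using r(1) D(2) by (intro exI[of _ r]) auto
  qed
  \<comment> \<open>The diagonal sequence is controlled by \<open>E k\<close> only from index
    \<open>Suc k\<close> on, hence the shift in the final choice of subsequence.\<close>
  have "\<forall>i j. (x ((diagseq \<circ> (+) (Suc k)) i), x ((diagseq \<circ> (+) (Suc k)) j)) \<in> E k" for k
    by (rule diagseq_holds) simp
  from this[rule_format, of _ 0 1] show ?thesis
    by (intro that[of "\<lambda>n. diagseq (Suc n)"]) (simp_all add: diagseq_mono strict_mono_Suc_iff)
qed

section \<open>Neighborhoods of the identity\<close>

context topological_group
begin

lemma one_nbhd_preimage:
  assumes "one_nbhd G T U" "continuous_map T T f" "f \<one> = \<one>"
  shows "one_nbhd G T {g \<in> carrier G. f g \<in> U}"
proof -
  obtain V where V: "openin T V" "\<one> \<in> V" "V \<subseteq> U"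
    using assms(1) unfolding one_nbhd_def by auto
  have "openin T {g \<in> carrier G. f g \<in> V}"
    using openin_continuous_map_preimage[OF assms(2) V(1)] by (simp add: topspace_eq)
  then show ?thesis
    unfolding one_nbhd_def
    by (intro conjI exI[of _ "{g \<in> carrier G. f g \<in> V}"]) (use V assms(3) in auto)
qed

lemma continuous_map_mult:
  assumes "continuous_map T T f" "continuous_map T T g"
  shows "continuous_map T T (\<lambda>x. f x \<otimes> g x)"
  using continuous_map_compose[OF continuous_map_pairedI[OF assms] continuous_mult]
  by (simp add: o_def)

lemma one_nbhd_conj:
  assumes "one_nbhd G T U" "a \<in> carrier G"
  shows "one_nbhd G T {g \<in> carrier G. a \<otimes> g \<otimes> inv a \<in> U}"
  by (rule one_nbhd_preimage[OF assms(1)])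
    (use assms(2) topspace_eq in \<open>auto intro!: continuous_map_mult continuous_map_id[unfolded id_def]\<close>)

lemma one_nbhd_subset: "one_nbhd G T U \<Longrightarrow> U \<subseteq> carrier G"
  unfolding one_nbhd_def by simp

lemma one_nbhd_symmetric:
  assumes "one_nbhd G T U"
  obtains V where "one_nbhd G T V" "V \<subseteq> U" "\<And>x. x \<in> V \<Longrightarrow> inv x \<in> V"
    "\<And>x y. x \<in> V \<Longrightarrow> y \<in> V \<Longrightarrow> x \<otimes> y \<in> U"
proof -
  obtain W where W: "one_nbhd G T W" "\<And>x y. x \<in> W \<Longrightarrow> y \<in> W \<Longrightarrow> x \<otimes> y \<in> U"
    using one_nbhd_square[OF assms] by blast
  let ?V = "W \<inter> {x \<in> carrier G. inv x \<in> W}"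
  \<comment> \<open>Each element of \<open>W\<close> is its own product with \<one>, which also lies
    in \<open>W\<close>.\<close>
  have "W \<subseteq> U"
    using W(2)[OF _ one_nbhd_one[OF W(1)]] one_nbhd_subset[OF W(1)] by fastforce
  then show ?thesis
    using W by (intro that[of ?V] one_nbhd_Int one_nbhd_inverse) auto
qed

text \<open>The square-root condition makes products with one factor from each of
  \<open>V 1\<close>, ..., \<open>V n\<close> collapse step by step into \<open>V 0\<close>, hence
  into \<open>U\<close>; the sets \<open>N n\<close> impose a further smallness condition on the
  single factors.\<close>

lemma one_nbhd_seq:
  assumes "one_nbhd G T U" "\<And>n. one_nbhd G T (N n)"
  obtains V where "\<And>n. one_nbhd G T (V n)" "\<And>n. V n \<subseteq> N n" "V 0 \<subseteq> U"
    "\<And>n x y. x \<in> V (Suc n) \<Longrightarrow> y \<in> V (Suc n) \<Longrightarrow> x \<otimes> y \<in> V n"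
proof -
  let ?P = "\<lambda>n W. one_nbhd G T W \<and> W \<subseteq> N n \<and> (n = 0 \<longrightarrow> W \<subseteq> U)"
  have "\<exists>V. \<forall>n. ?P n (V n) \<and> (\<forall>x\<in>V (Suc n). \<forall>y\<in>V (Suc n). x \<otimes> y \<in> V n)"
  proof (rule dependent_nat_choice)
    show "\<exists>W. ?P 0 W"
      using one_nbhd_Int[OF assms(1) assms(2)] by blast
    fix W n assume "?P n W"
    then obtain W' where W': "one_nbhd G T W'" "\<And>x y. x \<in> W' \<Longrightarrow> y \<in> W' \<Longrightarrow> x \<otimes> y \<in> W"
      using one_nbhd_square by blast
    then show "\<exists>W'. ?P (Suc n) W' \<and> (\<forall>x\<in>W'. \<forall>y\<in>W'. x \<otimes> y \<in> W)"
      using one_nbhd_Int[OF W'(1) assms(2), of "Suc n"] by (intro exI[of _ "W' \<inter> N (Suc n)"]) auto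
  qed
  then obtain V where "\<forall>n. ?P n (V n) \<and> (\<forall>x\<in>V (Suc n). \<forall>y\<in>V (Suc n). x \<otimes> y \<in> V n)" ..
  then show ?thesis
    by (intro that[of V]) auto
qed

text \<open>This is the subsequence lemma for the entourages of the Roelcke uniformity, read as a
  factorization in the group.\<close>

lemma roelcke_subseq:
  fixes g :: "nat \<Rightarrow> 'a" and V :: "nat \<Rightarrow> 'a set"
  assumes "roelcke_precompact G T" "\<And>n. g n \<in> carrier G" "\<And>n. one_nbhd G T (V n)"
  obtains r u v where "strict_mono (r :: nat \<Rightarrow> nat)" "\<And>n. u n \<in> V n" "\<And>n. v n \<in> V n"
    "\<And>n. g (r (Suc n)) = u n \<otimes> g (r n) \<otimes> v n"
proof -
  have E: "roelcke_entourage (V n) \<in> roelcke_filter" for n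
    using one_nbhd_subset[OF assms(3)]
    by (intro roelcke_filterI[OF _ assms(3)[of n]] roelcke_entourage_subset) auto
  have "totally_bounded_uniformity (carrier G) roelcke_filter"
    using assms(1) unfolding roelcke_precompact_def roelcke_uniformity_eq_filter .
  then obtain r where r: "strict_mono r"
    "\<And>n. (g (r n), g (r (Suc n))) \<in> roelcke_entourage (V n)"
    by (rule totally_bounded_uniformity_subseq[of _ _ g "\<lambda>n. roelcke_entourage (V n)",
          OF uniformity_structure_roelcke_filter _ assms(2) E]) blast
  have "\<forall>n. \<exists>u v. u \<in> V n \<and> v \<in> V n \<and> g (r (Suc n)) = u \<otimes> g (r n) \<otimes> v"
    using r(2) unfolding roelcke_entourage_def by blast
  then obtain u v where "\<And>n. u n \<in> V n \<and> v n \<in> V n \<and> g (r (Suc n)) = u n \<otimes> g (r n) \<otimes> v n"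
    by metis
  with r(1) that show ?thesis
    by blast
qed

end

section \<open>Effros' theorem for isometric actions\<close>

context isometric_continuous_action
begin

section \<open>Orbit maps and translation of balls under isometric actions\<close>

lemma action_closed [simp]: "g \<in> carrier G \<Longrightarrow> x \<in> X \<Longrightarrow> \<phi> g x \<in> X"
  using element_image by blast

lemma action_one [simp]: "x \<in> X \<Longrightarrow> \<phi> \<one> x = x"
  using id_eq_one by (metis restrict_apply')

lemma continuous_orbit_map:
  assumes "x \<in> X"
  shows "continuous_map T mtopology (\<lambda>g. \<phi> g x)"
proof -
  have "continuous_map T (prod_topology T mtopology) (\<lambda>g. (g, x))"
    using assms by (intro continuous_map_pairedI) (auto simp: id_def[symmetric])
  then show ?thesis
    using continuous_map_compose[OF _ continuous] by (fastforce simp: o_def)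
qed

lemma one_nbhd_dist:
  assumes "x \<in> X" "\<epsilon> > 0"
  shows "one_nbhd G T {g \<in> carrier G. d x (\<phi> g x) < \<epsilon>}"
proof -
  have "openin T {g \<in> topspace T. \<phi> g x \<in> mball x \<epsilon>}"
    by (rule openin_continuous_map_preimage[OF continuous_orbit_map[OF assms(1)]]) simp
  moreover have "{g \<in> topspace T. \<phi> g x \<in> mball x \<epsilon>} = {g \<in> carrier G. d x (\<phi> g x) < \<epsilon>}"
    using assms by (auto simp: topspace_eq)
  ultimately show ?thesis
    unfolding one_nbhd_def using assms
    by (intro conjI exI[of _ "{g \<in> carrier G. d x (\<phi> g x) < \<epsilon>}"]) auto
qed

lemma dist_inverse:
  assumes "g \<in> carrier G" "x \<in> X" "y \<in> X"
  shows "d (\<phi> (inv g) x) y = d x (\<phi> g y)"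
  using isometric[of g "\<phi> (inv g) x" y] composition_rule[of x g "inv g"] assms by simp

text \<open>The isometry given by \<open>inv g\<close> carries the ball around
  \<open>\<phi> g x\<close> to the ball of the same radius around \<open>x\<close>, and
  \<open>g \<otimes> h\<close> equals \<open>(g \<otimes> h \<otimes> inv g) \<otimes> g\<close>.
  The radius is thus kept while the neighborhood is conjugated.\<close>

lemma mball_subset_conj:
  assumes "mball x r \<subseteq> (\<lambda>h. \<phi> h x) ` W" "W \<subseteq> carrier G" "g \<in> carrier G" "x \<in> X"
    and "\<And>h. h \<in> W \<Longrightarrow> g \<otimes> h \<otimes> inv g \<in> U"
  shows "mball (\<phi> g x) r \<subseteq> (\<lambda>h. \<phi> h (\<phi> g x)) ` U"
proof
  fix y assume "y \<in> mball (\<phi> g x) r"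
  then have y: "y \<in> X" "d (\<phi> g x) y < r"
    by auto
  then have "\<phi> (inv g) y \<in> mball x r"
    using assms(3,4) dist_inverse[of g y x] by (simp add: commute)
  then obtain h where h: "h \<in> W" "\<phi> (inv g) y = \<phi> h x"
    using assms(1) by auto
  have hG: "h \<in> carrier G"
    using h(1) assms(2) by auto
  have "y = \<phi> g (\<phi> (inv g) y)"
    using composition_rule[of y g "inv g"] y(1) assms(3) by simp
  also have "\<dots> = \<phi> (g \<otimes> h) x"
    using composition_rule[of x g h] h(2) assms(3,4) hG by simp
  also have "\<dots> = \<phi> (g \<otimes> h \<otimes> inv g) (\<phi> g x)"
    using composition_rule[of x "g \<otimes> h \<otimes> inv g" g] assms(3,4) hG by (simp add: m_assoc)
  finally show "y \<in> (\<lambda>h. \<phi> h (\<phi> g x)) ` U"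
    using assms(5)[OF h(1)] by blast
qed

end

section \<open>Baire category and openness of orbit maps\<close>

locale polish_transitive_action =
  isometric_continuous_action G T X d \<phi> + transitive_action G X \<phi>
  for G (structure) and T and X and d and \<phi> +
  assumes completely_metrizable_group: "completely_metrizable_space T"
    and separable_group: "separable_space T"
    and complete_space: "mcomplete"
begin

text \<open>Countably many translates of \<open>V x\<close> cover \<open>X\<close>, so by Baire one of them is somewhere dense.\<close>

lemma one_nbhd_orbit_somewhere_dense:
  assumes "x \<in> X" "one_nbhd G T V" "\<And>g. g \<in> V \<Longrightarrow> inv g \<in> V"
  obtains c v r where "c \<in> carrier G" "v \<in> V" "r > 0"
    "mball (\<phi> (c \<otimes> v) x) r \<subseteq> mtopology closure_of ((\<lambda>g. \<phi> (c \<otimes> g) x) ` V)"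
proof -
  obtain C where C: "countable C" "C \<subseteq> carrier G" "T closure_of C = carrier G"
    using separable_group unfolding separable_space_def topspace_eq by blast
  obtain V' where V': "openin T V'" "\<one> \<in> V'" "V' \<subseteq> V"
    using assms(2) unfolding one_nbhd_def by auto
  have VG: "V \<subseteq> carrier G"
    using one_nbhd_subset[OF assms(2)] .
  define cl where "cl c = mtopology closure_of ((\<lambda>g. \<phi> (c \<otimes> g) x) ` V)" for c
  have sub: "(\<lambda>g. \<phi> (c \<otimes> g) x) ` V \<subseteq> X" if "c \<in> C" for c
    using that C(2) VG assms(1) by (auto intro!: action_closed)
  have "X \<subseteq> \<Union> (cl ` C)"
  proof
    fix y assume "y \<in> X"
    then obtain g where g: "g \<in> carrier G" "\<phi> g x = y"
      using unique_orbit assms(1) by blast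
    \<comment> \<open>The dense set \<open>C\<close> meets the open set of all
      \<open>g \<otimes> v\<close> with \<open>v\<close> in \<open>V'\<close>. For such a point
      \<open>c\<close>, the symmetry of \<open>V\<close> puts \<open>g\<close> into the translate of
      \<open>V\<close> by \<open>c\<close>.\<close>
    have "continuous_map T T (\<lambda>h. inv g \<otimes> h)"
      using g(1) topspace_eq
      by (intro continuous_map_mult) (auto intro: continuous_map_id[unfolded id_def])
    then have "openin T {h \<in> topspace T. inv g \<otimes> h \<in> V'}" (is "openin T ?O")
      using V'(1) by (rule openin_continuous_map_preimage)
    moreover have "g \<in> ?O \<inter> T closure_of C"
      using g(1) V'(2) C(3) topspace_eq by simp
    ultimately have "?O \<inter> C \<noteq> {}"
      using openin_Int_closure_of_eq_empty[of T ?O C] by blast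
    then obtain c where c: "c \<in> C" "inv g \<otimes> c \<in> V'"
      by auto
    have cG: "c \<in> carrier G"
      using c(1) C(2) by auto
    have "inv (inv g \<otimes> c) \<in> V"
      using c(2) V'(3) assms(3) by blast
    moreover have "c \<otimes> inv (inv g \<otimes> c) = g"
      using g(1) cG m_assoc[of c "inv c" g] by (simp add: inv_mult_group)
    ultimately have "y \<in> (\<lambda>g. \<phi> (c \<otimes> g) x) ` V"
      using g(2) by force
    then show "y \<in> \<Union> (cl ` C)"
      using c(1) closure_of_subset[of "(\<lambda>g. \<phi> (c \<otimes> g) x) ` V" mtopology] sub[OF c(1)]
      unfolding cl_def topspace_mtopology by blast
  qed
  moreover have "cl c \<subseteq> X" for c
    using closure_of_subset_topspace[of mtopology] unfolding cl_def by simp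
  ultimately have "\<Union> (cl ` C) = X"
    by blast
  then have "mtopology interior_of \<Union> (cl ` C) \<noteq> {}"
    using assms(1) interior_of_topspace[of mtopology] by auto
  moreover have "mtopology interior_of \<Union> (cl ` C) = {}"
    if "\<And>c. c \<in> C \<Longrightarrow> mtopology interior_of cl c = {}"
    by (rule metric_Baire_category_alt[OF complete_space])
      (use C(1) that in \<open>auto simp: cl_def\<close>)
  ultimately obtain c p where c: "c \<in> C" and p: "p \<in> mtopology interior_of cl c"
    by blast
  \<comment> \<open>An open set meeting a closure meets the set itself. The center of the ball can
    therefore be an orbit point \<open>\<phi> (c \<otimes> v) x\<close>, which can be translated
    back to \<open>x\<close>.\<close>
  have "mtopology interior_of cl c \<inter> cl c \<noteq> {}"
    using p interior_of_subset[of mtopology "cl c"] by blast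
  then have "mtopology interior_of cl c \<inter> (\<lambda>g. \<phi> (c \<otimes> g) x) ` V \<noteq> {}"
    using openin_Int_closure_of_eq_empty[OF openin_interior_of[of mtopology "cl c"],
        of "(\<lambda>g. \<phi> (c \<otimes> g) x) ` V"]
    unfolding cl_def by simp
  then obtain v where v: "v \<in> V" "\<phi> (c \<otimes> v) x \<in> mtopology interior_of cl c"
    by auto
  then obtain r where r: "r > 0" "mball (\<phi> (c \<otimes> v) x) r \<subseteq> mtopology interior_of cl c"
    using openin_interior_of[of mtopology "cl c"] unfolding openin_mtopology by blast
  have "mball (\<phi> (c \<otimes> v) x) r \<subseteq> cl c"
    using subset_trans[OF r(2) interior_of_subset] .
  with r(1) v(1) c C(2) show ?thesis
    unfolding cl_def by (intro that[of c v r]) auto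
qed

text \<open>Translating the ball of the Baire argument by the inverse of
  \<open>c \<otimes> v\<close> centers it at \<open>x\<close> and turns the factors
  \<open>c \<otimes> w\<close> into \<open>inv v \<otimes> w\<close>, which lie in \<open>U\<close>.
  The closure is removed only in \<open>effros\<close>.\<close>

lemma mball_subset_closure_orbit:
  assumes "x \<in> X" "one_nbhd G T U"
  obtains r where "r > 0" "mball x r \<subseteq> mtopology closure_of ((\<lambda>g. \<phi> g x) ` U)"
proof -
  obtain V where V: "one_nbhd G T V" "\<And>g. g \<in> V \<Longrightarrow> inv g \<in> V"
    "\<And>g h. g \<in> V \<Longrightarrow> h \<in> V \<Longrightarrow> g \<otimes> h \<in> U"
    using one_nbhd_symmetric[OF assms(2)] by metis
  have VG: "\<And>g. g \<in> V \<Longrightarrow> g \<in> carrier G"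
    using one_nbhd_subset[OF V(1)] by auto
  obtain c v r where c: "c \<in> carrier G" "v \<in> V" "r > 0"
    "mball (\<phi> (c \<otimes> v) x) r \<subseteq> mtopology closure_of ((\<lambda>g. \<phi> (c \<otimes> g) x) ` V)"
    using one_nbhd_orbit_somewhere_dense[OF assms(1) V(1,2)] by metis
  define a where "a = c \<otimes> v"
  have a: "a \<in> carrier G"
    using c VG by (simp add: a_def)
  have "y \<in> mtopology closure_of ((\<lambda>g. \<phi> g x) ` U)" if y: "y \<in> mball x r" for y
  proof -
    have yX: "y \<in> X"
      using y by simp
    have "\<phi> a y \<in> mball (\<phi> a x) r"
      using y a isometric by simp
    then have cl: "\<phi> a y \<in> mtopology closure_of ((\<lambda>g. \<phi> (c \<otimes> g) x) ` V)"
      using c(4) unfolding a_def by blast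
    have "\<exists>z\<in>(\<lambda>g. \<phi> g x) ` U. z \<in> mball y \<eta>" if "\<eta> > 0" for \<eta>
    proof -
      obtain w where w: "w \<in> V" "d (\<phi> a y) (\<phi> (c \<otimes> w) x) < \<eta>"
        using cl \<open>\<eta> > 0\<close> unfolding metric_closure_of by auto
      have "inv a \<otimes> (c \<otimes> w) = inv v \<otimes> w"
        using c(1,2) w(1) VG m_assoc[of "inv c" c w] by (simp add: a_def inv_mult_group m_assoc)
      then have "\<phi> (inv v \<otimes> w) x = \<phi> (inv a) (\<phi> (c \<otimes> w) x)"
        using composition_rule[of x "inv a" "c \<otimes> w"] a assms(1) c(1) w(1) VG by simp
      then have "d (\<phi> (inv v \<otimes> w) x) y < \<eta>"
        using dist_inverse[of a "\<phi> (c \<otimes> w) x" y] a assms(1) c(1) w VG yX by (simp add: commute)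
      moreover have "inv v \<otimes> w \<in> U"
        using V c(2) w(1) by blast
      ultimately show ?thesis
        using yX assms(1) c(2) w(1) VG by (intro bexI[OF _ imageI]) (auto simp: commute)
    qed
    then show ?thesis
      using yX unfolding metric_closure_of by blast
  qed
  with c(3) that show ?thesis
    by blast
qed

text \<open>
  Write the two sides of the desired equation \<open>g x = h y\<close> as limits of \<open>c (2 n) x\<close> and
  \<open>c (2 n + 1) y\<close>, where in turn the last but one of the group elements is corrected by a left
  factor so small that both subsequences of \<open>c\<close> are Cauchy for a complete metric \<open>D\<close> of \<open>G\<close>.
\<close>

theorem effros:
  assumes x: "x \<in> X" and U: "one_nbhd G T U"
  obtains r where "r > 0" "mball x r \<subseteq> (\<lambda>g. \<phi> g x) ` U"
proof -
  obtain V where V: "one_nbhd G T V" "\<And>g. g \<in> V \<Longrightarrow> inv g \<in> V"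
    "\<And>g h. g \<in> V \<Longrightarrow> h \<in> V \<Longrightarrow> g \<otimes> h \<in> U"
    using one_nbhd_symmetric[OF U] by metis
  obtain M D where MD: "Metric_space M D" "Metric_space.mcomplete M D" "T = Metric_space.mtopology M D"
    using completely_metrizable_group unfolding completely_metrizable_space_def by blast
  interpret GM: Metric_space M D
    by (fact MD(1))
  have M: "M = carrier G"
    using topspace_eq unfolding MD(3) by simp
  obtain V' where V': "openin T V'" "\<one> \<in> V'" "V' \<subseteq> V"
    using V(1) unfolding one_nbhd_def by auto
  then obtain \<epsilon>' where \<epsilon>': "\<epsilon>' > 0" "GM.mball \<one> \<epsilon>' \<subseteq> V'"
    unfolding MD(3) GM.openin_mtopology by blast
  \<comment> \<open>The limits supplied by \<open>geometric_limit\<close> are within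
    \<open>2 * \<epsilon>\<close> of \<one>; a third keeps this below the radius
    \<open>\<epsilon>'\<close>.\<close>
  define \<epsilon> where "\<epsilon> = \<epsilon>' / 3"
  have "\<epsilon> > 0"
    using \<epsilon>'(1) by (simp add: \<epsilon>_def)
  have \<epsilon>V: "g \<in> V" if "g \<in> carrier G" "D \<one> g \<le> 2 * \<epsilon>" for g
  proof -
    have "g \<in> GM.mball \<one> \<epsilon>'"
      unfolding GM.in_mball using that \<epsilon>'(1) by (simp add: \<epsilon>_def M)
    then show ?thesis
      using \<epsilon>'(2) V'(3) by blast
  qed
  \<comment> \<open>The metric \<open>D\<close> need not be invariant, so how small a left factor
    must be depends on the element \<open>a\<close> that it corrects.\<close>
  define N where "N n a = {u \<in> carrier G. D a (u \<otimes> a) < \<epsilon> / 2 ^ n}" for n :: nat and a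
  have N: "one_nbhd G T (N n a)" if "a \<in> carrier G" for n a
  proof -
    have "continuous_map T T (\<lambda>u. u \<otimes> a)"
      using that topspace_eq
      by (intro continuous_map_mult) (auto intro: continuous_map_id[unfolded id_def])
    then have "openin T {u \<in> topspace T. u \<otimes> a \<in> GM.mball a (\<epsilon> / 2 ^ n)}"
      by (rule openin_continuous_map_preimage) (simp add: MD(3))
    moreover have "{u \<in> topspace T. u \<otimes> a \<in> GM.mball a (\<epsilon> / 2 ^ n)} = N n a"
      unfolding GM.in_mball using that by (auto simp: N_def topspace_eq M)
    moreover have "\<one> \<in> N n a"
      using that \<open>\<epsilon> > 0\<close> by (simp add: N_def M)
    ultimately show ?thesis
      unfolding one_nbhd_def by (intro conjI exI[of _ "N n a"]) (auto simp: N_def)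
  qed
  obtain r0 where r0: "r0 > 0" "mball x r0 \<subseteq> mtopology closure_of ((\<lambda>u. \<phi> u x) ` N 0 \<one>)"
    using mball_subset_closure_orbit[OF x N[OF one_closed]] by blast
  \<comment> \<open>The bound \<open>r0\<close> starts the closure condition of the recursion below,
    the bound 1 its distance condition at \<open>n = 0\<close>.\<close>
  define r where "r = min r0 1"
  have "y \<in> (\<lambda>g. \<phi> g x) ` U" if "y \<in> mball x r" for y
  proof -
    from that have y: "y \<in> X" "d x y < 1" "y \<in> mball x r0"
      by (auto simp: r_def)
    define pt where "pt n = (if even n then x else y)" for n :: nat
    have pt: "pt n \<in> X" "pt (Suc (Suc n)) = pt n" for n
      using x y(1) by (simp_all add: pt_def)
    \<comment> \<open>The state \<open>(a, b)\<close> holds two consecutive elements, since a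
      correction replaces \<open>a\<close> by a nearby \<open>u \<otimes> a\<close> and keeps
      \<open>b\<close>. The closure condition is what makes the next correction possible.\<close>
    let ?P = "\<lambda>n (a, b). a \<in> carrier G \<and> b \<in> carrier G \<and>
      d (\<phi> a (pt n)) (\<phi> b (pt (Suc n))) < (1 / 2) ^ n \<and>
      \<phi> b (pt (Suc n)) \<in> mtopology closure_of ((\<lambda>u. \<phi> u (\<phi> a (pt n))) ` N n a) \<and>
      (n = 0 \<longrightarrow> a = \<one> \<and> b = \<one>)"
    let ?Q = "\<lambda>n ab ab'. fst ab' = snd ab \<and> D (fst ab) (snd ab') < \<epsilon> / 2 ^ n"
    have "\<exists>f. \<forall>n. ?P n (f n) \<and> ?Q n (f n) (f (Suc n))"
    proof (rule dependent_nat_choice)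
      have "?P 0 (\<one>, \<one>)"
        using x y r0(2) by (auto simp: pt_def subset_iff)
      then show "\<exists>ab. ?P 0 ab" ..
      fix ab n assume *: "?P n ab"
      obtain a b where ab: "ab = (a, b)"
        by fastforce
      define p q where "p = \<phi> a (pt n)" and "q = \<phi> b (pt (Suc n))"
      have a: "a \<in> carrier G" "b \<in> carrier G" "q \<in> mtopology closure_of ((\<lambda>u. \<phi> u p) ` N n a)"
        using * unfolding ab p_def q_def by auto
      have pq: "p \<in> X" "q \<in> X"
        using a(1,2) pt(1) by (simp_all add: p_def q_def)
      \<comment> \<open>Moving the point \<open>p\<close> into the ball of radius \<open>s\<close>
        around \<open>q\<close> reestablishes the closure condition with the roles of the two points
        exchanged.\<close>
      obtain s where s: "s > 0"
        "mball q s \<subseteq> mtopology closure_of ((\<lambda>u. \<phi> u q) ` N (Suc n) b)"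
        using mball_subset_closure_orbit[OF pq(2) N[OF a(2)]] by blast
      have "min s ((1 / 2) ^ Suc n) > 0"
        using s(1) by simp
      then obtain u where u: "u \<in> N n a" "\<phi> u p \<in> mball q (min s ((1 / 2) ^ Suc n))"
        using a(3) unfolding metric_closure_of by blast
      have uG: "u \<in> carrier G"
        using u(1) by (simp add: N_def)
      have up: "\<phi> (u \<otimes> a) (pt n) = \<phi> u p"
        using composition_rule[OF pt(1) uG a(1)] by (simp add: p_def)
      have P: "?P (Suc n) (b, u \<otimes> a)"
        using u(2) s(2) a(1,2) uG unfolding pt(2) prod.case up q_def[symmetric]
        by (auto simp: subset_iff)
      have Q: "?Q n ab (b, u \<otimes> a)"
        using u(1) by (simp add: ab N_def)
      show "\<exists>ab'. ?P (Suc n) ab' \<and> ?Q n ab ab'"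
        by (rule exI[of _ "(b, u \<otimes> a)"], rule conjI, rule P, rule Q)
    qed
    then obtain f where f: "\<forall>n. ?P n (f n) \<and> ?Q n (f n) (f (Suc n))" ..
    have fP: "?P n (f n)" and fQ: "?Q n (f n) (f (Suc n))" for n
      by (rule conjunct1[OF spec[OF f]], rule conjunct2[OF spec[OF f]])
    define c where "c n = fst (f n)" for n
    have snd_f: "snd (f n) = c (Suc n)" for n
      using fQ by (simp add: c_def)
    have f_eq: "f n = (c n, c (Suc n))" for n
      using snd_f[of n] by (simp add: c_def prod_eq_iff)
    have c: "c n \<in> carrier G" "d (\<phi> (c n) (pt n)) (\<phi> (c (Suc n)) (pt (Suc n))) < (1 / 2) ^ n"
      "D (c n) (c (Suc (Suc n))) < \<epsilon> / 2 ^ n" for n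
      using fP[of n] fQ[of n] by (simp_all add: f_eq)
    have c01: "c 0 = \<one>" "c 1 = \<one>"
      using fP[of 0] by (simp_all add: f_eq)
    have le: "\<epsilon> / 2 ^ m \<le> \<epsilon> / 2 ^ n" if "n \<le> m" for m n :: nat
      using that \<open>\<epsilon> > 0\<close> by (intro divide_left_mono) auto
    have "D (c (2 * n)) (c (2 * Suc n)) \<le> \<epsilon> / 2 ^ n" for n
      using c(3)[of "2 * n"] le[of n "2 * n"] by simp
    then obtain g where g: "limitin T (\<lambda>n. c (2 * n)) g sequentially" "g \<in> carrier G"
      "D \<one> g \<le> 2 * \<epsilon>"
      using GM.geometric_limit[OF MD(2), of "\<lambda>n. c (2 * n)" \<epsilon>] c(1) c01 by (auto simp: M MD(3))
    have "D (c (2 * n + 1)) (c (2 * Suc n + 1)) \<le> \<epsilon> / 2 ^ n" for n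
      using c(3)[of "2 * n + 1"] le[of n "2 * n + 1"] by simp
    then obtain h where h: "limitin T (\<lambda>n. c (2 * n + 1)) h sequentially" "h \<in> carrier G"
      "D \<one> h \<le> 2 * \<epsilon>"
      using GM.geometric_limit[OF MD(2), of "\<lambda>n. c (2 * n + 1)" \<epsilon>] c(1) c01 by (auto simp: M MD(3))
    have "limitin mtopology (\<lambda>n. \<phi> (c (2 * n)) x) (\<phi> g x) sequentially"
      using continuous_map_limit[OF continuous_orbit_map[OF x] g(1)] by (simp add: o_def)
    then have lim_x: "(\<lambda>n. d (\<phi> (c (2 * n)) x) (\<phi> g x)) \<longlonglongrightarrow> 0"
      by (simp add: limitin_metric_dist_null)
    have "limitin mtopology (\<lambda>n. \<phi> (c (2 * n + 1)) y) (\<phi> h y) sequentially"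
      using continuous_map_limit[OF continuous_orbit_map[OF y(1)] h(1)] by (simp add: o_def)
    then have lim_y: "(\<lambda>n. d (\<phi> (c (2 * n + 1)) y) (\<phi> h y)) \<longlonglongrightarrow> 0"
      by (simp add: limitin_metric_dist_null)
    have "(\<lambda>n. (1 / 4 :: real) ^ n) \<longlonglongrightarrow> 0"
      by (rule LIMSEQ_power_zero) simp
    from tendsto_add[OF tendsto_add[OF lim_x this] lim_y]
    have lim: "(\<lambda>n. d (\<phi> (c (2 * n)) x) (\<phi> g x) + (1 / 4) ^ n + d (\<phi> (c (2 * n + 1)) y) (\<phi> h y))
      \<longlonglongrightarrow> 0"
      by simp
    have bound: "d (\<phi> g x) (\<phi> h y) \<le>
      d (\<phi> (c (2 * n)) x) (\<phi> g x) + (1 / 4) ^ n + d (\<phi> (c (2 * n + 1)) y) (\<phi> h y)" for n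
    proof -
      have "d (\<phi> (c (2 * n)) x) (\<phi> (c (2 * n + 1)) y) < (1 / 4) ^ n"
        using c(2)[of "2 * n"] by (simp add: pt_def power_mult power_divide)
      moreover have "\<phi> (c (2 * n)) x \<in> X" "\<phi> (c (2 * n + 1)) y \<in> X" "\<phi> g x \<in> X" "\<phi> h y \<in> X"
        using c(1) x y(1) g(2) h(2) by simp_all
      ultimately show ?thesis
        using triangle[of "\<phi> g x" "\<phi> (c (2 * n)) x" "\<phi> h y"]
          triangle[of "\<phi> (c (2 * n)) x" "\<phi> (c (2 * n + 1)) y" "\<phi> h y"]
          commute[of "\<phi> g x" "\<phi> (c (2 * n)) x"] by linarith
    qed
    have "d (\<phi> g x) (\<phi> h y) \<le> 0"
      using LIMSEQ_le_const[OF lim] bound by blast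
    then have "\<phi> g x = \<phi> h y"
      using zero[of "\<phi> g x" "\<phi> h y"] nonneg[of "\<phi> g x" "\<phi> h y"] g(2) h(2) x y(1) by simp
    then have "y = \<phi> (inv h) (\<phi> g x)"
      using orbit_sym_aux[of h y] h(2) y(1) by simp
    also have "\<dots> = \<phi> (inv h \<otimes> g) x"
      using composition_rule[OF x, of "inv h" g] g(2) h(2) by simp
    finally show ?thesis
      using V(3)[OF V(2)[OF \<epsilon>V[OF h(2,3)]] \<epsilon>V[OF g(2,3)]] by blast
  qed
  moreover have "r > 0"
    using r0(1) by (simp add: r_def)
  ultimately show ?thesis
    using that[of r] by blast
qed

section \<open>Local uniformity and the contradiction along a Roelcke subsequence\<close>

text \<open>Near \<open>z\<close> any two points have the form \<open>\<phi> g z\<close> and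
  \<open>\<phi> h z\<close> with \<open>g\<close> and \<open>h\<close> in \<open>V\<close>, so
  \<open>h \<otimes> inv g\<close> carries the first to the second. Halving the radius keeps the
  balls around \<open>p\<close> in this region.\<close>

lemma effros_uniform_near:
  assumes z: "z \<in> X" and U: "one_nbhd G T U"
  obtains r where "r > 0" "\<And>p. p \<in> mball z r \<Longrightarrow> mball p r \<subseteq> (\<lambda>g. \<phi> g p) ` U"
proof -
  obtain V where V: "one_nbhd G T V" "\<And>g. g \<in> V \<Longrightarrow> inv g \<in> V"
    "\<And>g h. g \<in> V \<Longrightarrow> h \<in> V \<Longrightarrow> g \<otimes> h \<in> U"
    using one_nbhd_symmetric[OF U] by metis
  obtain r where r: "r > 0" "mball z r \<subseteq> (\<lambda>g. \<phi> g z) ` V"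
    using effros[OF z V(1)] by blast
  have "mball p (r / 2) \<subseteq> (\<lambda>g. \<phi> g p) ` U" if p: "p \<in> mball z (r / 2)" for p
  proof
    fix y assume y: "y \<in> mball p (r / 2)"
    have "mball p (r / 2) \<subseteq> mball z r"
      using p z by (intro mball_subset) (auto simp: commute)
    then obtain h where h: "h \<in> V" "y = \<phi> h z"
      using y r(2) by blast
    have "p \<in> mball z r"
      using p r(1) by auto
    then obtain g where g: "g \<in> V" "p = \<phi> g z"
      using r(2) by blast
    have gh: "g \<in> carrier G" "h \<in> carrier G"
      using g(1) h(1) one_nbhd_subset[OF V(1)] by auto
    then have "\<phi> (h \<otimes> inv g) p = y"
      using composition_rule[of p h "inv g"] orbit_sym_aux[OF gh(1) z g(2)[symmetric]] p h(2) by simp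
    then show "y \<in> (\<lambda>g. \<phi> g p) ` U"
      using V(3)[OF h(1) V(2)[OF g(1)]] by blast
  qed
  with r(1) show ?thesis
    by (intro that[of "r / 2"]) auto
qed

theorem uniformly_micro_transitive:
  assumes "roelcke_precompact G T"
  shows "uniformly_micro_transitive G T X d \<phi>"
  unfolding uniformly_micro_transitive_def
proof (intro allI impI, rule ccontr)
  fix U assume U: "one_nbhd G T U"
  assume "\<not> (\<exists>\<delta>>0. \<forall>x\<in>X. mball x \<delta> \<inter> orbit G \<phi> x \<subseteq> (\<lambda>g. \<phi> g x) ` U)"
  then have bad: "\<exists>x\<in>X. \<not> mball x \<delta> \<subseteq> (\<lambda>g. \<phi> g x) ` U" if "\<delta> > 0" for \<delta>
    using that by blast
  then obtain x0 where x0: "x0 \<in> X"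
    using zero_less_one by blast
  have "\<forall>n. \<exists>g\<in>carrier G. \<not> mball (\<phi> g x0) (1 / Suc n) \<subseteq> (\<lambda>h. \<phi> h (\<phi> g x0)) ` U"
  proof
    fix n
    obtain x where x: "x \<in> X" "\<not> mball x (1 / Suc n) \<subseteq> (\<lambda>g. \<phi> g x) ` U"
      using bad[of "1 / Suc n"] by auto
    moreover obtain g where "g \<in> carrier G" "\<phi> g x0 = x"
      using unique_orbit[OF x0 x(1)] by blast
    ultimately show "\<exists>g\<in>carrier G. \<not> mball (\<phi> g x0) (1 / Suc n) \<subseteq> (\<lambda>h. \<phi> h (\<phi> g x0)) ` U"
      by (intro bexI[of _ g]) simp_all
  qed
  then obtain g where g: "\<And>n. g n \<in> carrier G"
    "\<And>n. \<not> mball (\<phi> (g n) x0) (1 / Suc n) \<subseteq> (\<lambda>h. \<phi> h (\<phi> (g n) x0)) ` U"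
    by metis
  \<comment> \<open>Two square roots of \<open>U\<close> are taken because the final conjugate is a
    product of three elements of \<open>V\<close>.\<close>
  obtain V' where V': "one_nbhd G T V'" "\<And>g h. g \<in> V' \<Longrightarrow> h \<in> V' \<Longrightarrow> g \<otimes> h \<in> U"
    using one_nbhd_symmetric[OF U] by metis
  obtain V where V: "one_nbhd G T V" "V \<subseteq> V'" "\<And>g. g \<in> V \<Longrightarrow> inv g \<in> V"
    "\<And>g h. g \<in> V \<Longrightarrow> h \<in> V \<Longrightarrow> g \<otimes> h \<in> V'"
    using one_nbhd_symmetric[OF V'(1)] by metis
  have VG: "\<And>g. g \<in> V \<Longrightarrow> g \<in> carrier G"
    using one_nbhd_subset[OF V(1)] by auto
  have "one_nbhd G T {h \<in> carrier G. d x0 (\<phi> h x0) < (1 / 2) ^ n}" for n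
    by (rule one_nbhd_dist[OF x0]) simp
  then obtain W where W: "\<And>n. one_nbhd G T (W n)"
    "\<And>n. W n \<subseteq> {h \<in> carrier G. d x0 (\<phi> h x0) < (1 / 2) ^ n}" "W 0 \<subseteq> V"
    "\<And>n x y. x \<in> W (Suc n) \<Longrightarrow> y \<in> W (Suc n) \<Longrightarrow> x \<otimes> y \<in> W n"
    by (rule one_nbhd_seq[of V "\<lambda>n. {h \<in> carrier G. d x0 (\<phi> h x0) < (1 / 2) ^ n}", OF V(1)]) blast
  \<comment> \<open>Starting the factors at \<open>W (Suc n)\<close> leaves \<open>W 0\<close>, a
    subset of \<open>V\<close>, for the accumulated left products.\<close>
  obtain r u v where r: "strict_mono r" and u: "\<And>n. u n \<in> W (Suc n)"
    and v: "\<And>n. v n \<in> W (Suc n)" and step: "\<And>n. g (r (Suc n)) = u n \<otimes> g (r n) \<otimes> v n"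
    by (rule roelcke_subseq[OF assms, of g "\<lambda>n. W (Suc n)"]) (use g(1) W(1) in auto)
  have WG: "\<And>n h. h \<in> W n \<Longrightarrow> h \<in> carrier G"
    using W(2) by blast
  have uG: "u n \<in> carrier G" and vG: "v n \<in> carrier G" for n
    using u v WG by blast+
  define a where "a = g (r 0)"
  have a: "a \<in> carrier G"
    using g(1) by (simp add: a_def)
  \<comment> \<open>The left factors accumulate to
    \<open>u (n - 1) \<otimes> ... \<otimes> u 0\<close>, the right ones to
    \<open>v 0 \<otimes> ... \<otimes> v (n - 1)\<close>.\<close>
  define t where "t = rec_nat \<one> (\<lambda>n t. u n \<otimes> t)"
  define w where "w = rec_nat \<one> (\<lambda>n w. w \<otimes> v n)"
  have t_simps [simp]: "t 0 = \<one>" "t (Suc n) = u n \<otimes> t n"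
    and w_simps [simp]: "w 0 = \<one>" "w (Suc n) = w n \<otimes> v n" for n
    by (simp_all add: t_def w_def)
  have tG [simp]: "t n \<in> carrier G" and wG [simp]: "w n \<in> carrier G" for n
    by (induction n) (simp_all add: uG vG)
  have g_eq: "g (r n) = t n \<otimes> a \<otimes> w n" for n
    by (induction n) (simp_all add: a a_def[symmetric] step uG vG m_assoc)
  \<comment> \<open>The additional factor \<open>h\<close> carries the induction:
    \<open>h \<otimes> u n\<close> lies in \<open>W n\<close> and takes its place one level
    lower.\<close>
  have "h \<in> W n \<Longrightarrow> h \<otimes> t n \<in> V" for h n
  proof (induction n arbitrary: h)
    case 0
    then show ?case
      using W(3) WG[OF 0] by auto
  next
    case (Suc n)
    have "(h \<otimes> u n) \<otimes> t n \<in> V"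
      using Suc.IH[OF W(4)[OF Suc.prems u]] .
    then show ?case
      using WG[OF Suc.prems] by (simp add: uG m_assoc)
  qed
  from this[OF one_nbhd_one[OF W(1)]] have tV: "t n \<in> V" for n
    by simp
  \<comment> \<open>As \<open>w n\<close> acts isometrically, the new right factor moves the orbit
    point exactly as far as \<open>v n\<close> moves \<open>x0\<close>.\<close>
  have "d (\<phi> (w n) x0) (\<phi> (w (Suc n)) x0) \<le> 1 / 2 ^ n" for n
  proof -
    have "d (\<phi> (w n) x0) (\<phi> (w (Suc n)) x0) = d x0 (\<phi> (v n) x0)"
      using composition_rule[OF x0 wG vG] isometric[OF wG x0] vG x0 by simp
    also have "\<dots> \<le> (1 / 2) ^ Suc n"
      using v[of n] W(2)[of "Suc n"] by fastforce
    also have "\<dots> \<le> 1 / 2 ^ n"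
      by (simp add: power_divide frac_le)
    finally show ?thesis .
  qed
  then obtain z where z: "z \<in> X" "limitin mtopology (\<lambda>n. \<phi> (w n) x0) z sequentially"
    using geometric_limit[OF complete_space, of "\<lambda>n. \<phi> (w n) x0" 1] x0 by auto
  \<comment> \<open>The set \<open>A\<close> depends on \<open>a\<close> but not on
    \<open>n\<close>, so one radius \<open>\<rho>\<close> serves for all late terms of the
    sequence.\<close>
  define A where "A = {h \<in> carrier G. a \<otimes> h \<otimes> inv a \<in> V}"
  have "one_nbhd G T A"
    unfolding A_def by (rule one_nbhd_conj[OF V(1) a])
  then obtain \<rho> where \<rho>: "\<rho> > 0" "\<And>p. p \<in> mball z \<rho> \<Longrightarrow> mball p \<rho> \<subseteq> (\<lambda>h. \<phi> h p) ` A"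
    using effros_uniform_near[OF z(1)] by metis
  obtain N where N: "\<And>n. n \<ge> N \<Longrightarrow> d (\<phi> (w n) x0) z < \<rho>"
    using z(2) \<rho>(1) unfolding limit_metric_sequentially by blast
  obtain k where k: "1 / Suc k < \<rho>"
    using nat_approx_posE[OF \<rho>(1)] by auto
  \<comment> \<open>The bound \<open>N\<close> brings \<open>\<phi> (w n) x0\<close> close to
    \<open>z\<close>; the bound \<open>k\<close>, with \<open>n \<le> r n\<close>, makes the radius
    of the bad ball at most \<open>\<rho>\<close>.\<close>
  define n where "n = max N k"
  have "k \<le> r n"
    using seq_suble[OF r, of n] by (simp add: n_def)
  then have rn: "1 / Suc (r n) \<le> \<rho>"
    using k frac_le[of 1 1 "real (Suc k)" "real (Suc (r n))"] by simp
  have "\<phi> (w n) x0 \<in> mball z \<rho>"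
    using N[of n] z(1) x0 by (simp add: n_def commute)
  then have "mball (\<phi> (w n) x0) \<rho> \<subseteq> (\<lambda>h. \<phi> h (\<phi> (w n) x0)) ` A"
    by (rule \<rho>(2))
  then have "mball (\<phi> (t n \<otimes> a) (\<phi> (w n) x0)) \<rho> \<subseteq>
      (\<lambda>h. \<phi> h (\<phi> (t n \<otimes> a) (\<phi> (w n) x0))) ` U"
  proof (rule mball_subset_conj)
    fix h assume h: "h \<in> A"
    then have "(t n \<otimes> (a \<otimes> h \<otimes> inv a)) \<otimes> inv (t n) \<in> U"
      using V(2,3,4) tV by (intro V'(2)) (auto simp: A_def)
    then show "t n \<otimes> a \<otimes> h \<otimes> inv (t n \<otimes> a) \<in> U"
      using h a by (simp add: A_def m_assoc inv_mult_group)
  qed (use a x0 in \<open>auto simp: A_def\<close>)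
  moreover have "\<phi> (t n \<otimes> a) (\<phi> (w n) x0) = \<phi> (g (r n)) x0"
    using composition_rule[OF x0, of "t n \<otimes> a" "w n"] a by (simp add: g_eq)
  moreover have "mball p (1 / Suc (r n)) \<subseteq> mball p \<rho>" for p
    using rn by auto
  ultimately have "mball (\<phi> (g (r n)) x0) (1 / Suc (r n)) \<subseteq> (\<lambda>h. \<phi> h (\<phi> (g (r n)) x0)) ` U"
    by (metis subset_trans)
  with g(2) show False
    by blast
qed
end

theorem theorem5p9:
  fixes G :: "('a, 'c) monoid_scheme" and T :: "'a topology"
    and X :: "'b set" and d :: "'b \<Rightarrow> 'b \<Rightarrow> real" and \<phi> :: "'a \<Rightarrow> 'b \<Rightarrow> 'b"
  assumes "polish_group G T" and "roelcke_precompact G T"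
    and "polish_metric_space X d"
    and "isometric_continuous_action G T X d \<phi>"
    and "transitive_action G X \<phi>"
  shows "uniformly_micro_transitive G T X d \<phi>"
proof -
  interpret polish_transitive_action G T X d \<phi>
    using assms
    by (intro polish_transitive_action.intro polish_transitive_action_axioms.intro)
      (auto simp: polish_group_def polish_group_axioms_def polish_metric_space_def
        polish_metric_space_axioms_def)
  show ?thesis
    using assms(2) by (rule uniformly_micro_transitive)
qed

end
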